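(* For each first-order formula $\varphi(X,Y;\tilde P)$ in the language of $\mathcal{E}$ (with $\tilde P$ a tuple of parameter variables) one can effectively find a number $k$ such that for every finite class $\mathbf{R}$ of pairwise disjoint infinite computable sets with $|\mathbf{R}|\ge k$ and every tuple $\tilde A$ of c.e. sets, the relation $\{(X,Y):X,Y\in\mathbf{R},\ \mathcal{E}\models\varphi(X,Y;\tilde A)\}$ is not a linear ordering of $\mathbf{R}$.
   Context: $\mathcal{E}$ is the lattice of c.e. subsets of $\mathbb{N}$ under inclusion. *)

theory Defs
  imports Main "HOL-Library.Nat_Bijection"
begin

section \<open>Computable functions, computable sets and c.e. sets\<close>

datatype recf =
    Zero
  | Succ
  | Proj nat
  | Comp recf "recf list"
  | PrimRec recf recf
  | Mu recf

text \<open>\<open>computes p xs y\<close>: the partial recursive function with description \<open>p\<close> converges on the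
  arguments \<open>xs\<close> with value \<open>y\<close>. An ill-formed application (such as \<open>Succ\<close> to two arguments)
  diverges. In \<open>PrimRec f g\<close> the recursion argument comes first, and \<open>g\<close> receives the
  predecessor, the previous value and the remaining arguments, in this order.\<close>

inductive computes :: "recf \<Rightarrow> nat list \<Rightarrow> nat \<Rightarrow> bool" where
  Zero: "computes Zero xs 0"
| Succ: "computes Succ [x] (Suc x)"
| Proj: "i < length xs \<Longrightarrow> computes (Proj i) xs (xs ! i)"
| Comp: "list_all2 (\<lambda>g y. computes g xs y) gs ys \<Longrightarrow> computes f ys z \<Longrightarrow>
    computes (Comp f gs) xs z"
| PrimRec_0: "computes f xs y \<Longrightarrow> computes (PrimRec f g) (0 # xs) y"
| PrimRec_Suc: "computes (PrimRec f g) (n # xs) r \<Longrightarrow> computes g (n # r # xs) y \<Longrightarrow>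
    computes (PrimRec f g) (Suc n # xs) y"
| Mu: "computes f (n # xs) 0 \<Longrightarrow> \<forall>m<n. \<exists>y>0. computes f (m # xs) y \<Longrightarrow>
    computes (Mu f) xs n"

lemma computes_unique: "computes p xs y \<Longrightarrow> computes p xs y' \<Longrightarrow> y = y'"
proof (induction arbitrary: y' rule: computes.induct)
  case (Zero xs)
  then show ?case by cases simp
next
  case (Succ x)
  then show ?case by cases simp
next
  case (Proj i xs)
  from Proj.prems show ?case by cases simp
next
  case (Comp xs gs ys f z)
  from Comp.prems obtain ys' where
    c: "list_all2 (\<lambda>g y. computes g xs y) gs ys'" "computes f ys' y'"
    by cases blast
  have "ys = ys'"
  proof (rule nth_equalityI)
    show "length ys = length ys'"
      using Comp.IH(1) c(1) by (simp add: list_all2_conv_all_nth)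
  next
    fix i assume i: "i < length ys"
    have "i < length gs" "computes (gs ! i) xs (ys' ! i)"
      using Comp.IH(1) c(1) i by (simp_all add: list_all2_conv_all_nth)
    moreover have "computes (gs ! i) xs z \<Longrightarrow> ys ! i = z" for z
      using list_all2_nthD2[OF Comp.IH(1) i] by blast
    ultimately show "ys ! i = ys' ! i" by blast
  qed
  with c(2) Comp.IH(2) show ?case by blast
next
  case (PrimRec_0 f xs y g)
  from PrimRec_0.prems show ?case by cases (rule PrimRec_0.IH)
next
  case (PrimRec_Suc f g n xs r y)
  from PrimRec_Suc.prems show ?case
    by cases (use PrimRec_Suc.IH in blast)
next
  case (Mu f n xs)
  from Mu.prems show ?case
  proof cases
    case m: Mu
    show ?thesis
    proof (rule linorder_cases[of n y'])
      assume "n < y'"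
      then obtain y where "0 < y" "computes f (n # xs) y" using m(2) by blast
      then show ?thesis using Mu.IH(1) by fastforce
    next
      assume "y' < n"
      then obtain y where "0 < y" "\<forall>z. computes f (y' # xs) z \<longrightarrow> y = z" using Mu.IH(2) by blast
      then show ?thesis using m(1) by fastforce
    qed
  qed
qed

definition computable_fun :: "(nat \<Rightarrow> nat) \<Rightarrow> bool" where
  "computable_fun f \<longleftrightarrow> (\<exists>p. \<forall>x. computes p [x] (f x))"

definition computable_set :: "nat set \<Rightarrow> bool" where
  "computable_set A \<longleftrightarrow> computable_fun (\<lambda>x. if x \<in> A then 1 else 0)"

definition ce :: "nat set \<Rightarrow> bool" where
  "ce A \<longleftrightarrow> A = {} \<or> (\<exists>f. computable_fun f \<and> A = range f)"


section \<open>First-order formulas in the language of partial orders\<close>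

datatype fm =
    Eq nat nat
  | Le nat nat
  | Neg fm
  | Conj fm fm
  | Disj fm fm
  | Imp fm fm
  | All nat fm
  | Ex nat fm

primrec fv :: "fm \<Rightarrow> nat set" where
  "fv (Eq i j) = {i, j}"
| "fv (Le i j) = {i, j}"
| "fv (Neg \<phi>) = fv \<phi>"
| "fv (Conj \<phi> \<psi>) = fv \<phi> \<union> fv \<psi>"
| "fv (Disj \<phi> \<psi>) = fv \<phi> \<union> fv \<psi>"
| "fv (Imp \<phi> \<psi>) = fv \<phi> \<union> fv \<psi>"
| "fv (All i \<phi>) = fv \<phi> - {i}"
| "fv (Ex i \<phi>) = fv \<phi> - {i}"

text \<open>Satisfaction in the structure with universe \<open>U\<close> and order \<open>le\<close>.\<close>

primrec sat :: "'a set \<Rightarrow> ('a \<Rightarrow> 'a \<Rightarrow> bool) \<Rightarrow> (nat \<Rightarrow> 'a) \<Rightarrow> fm \<Rightarrow> bool" where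
  "sat U le v (Eq i j) \<longleftrightarrow> v i = v j"
| "sat U le v (Le i j) \<longleftrightarrow> le (v i) (v j)"
| "sat U le v (Neg \<phi>) \<longleftrightarrow> \<not> sat U le v \<phi>"
| "sat U le v (Conj \<phi> \<psi>) \<longleftrightarrow> sat U le v \<phi> \<and> sat U le v \<psi>"
| "sat U le v (Disj \<phi> \<psi>) \<longleftrightarrow> sat U le v \<phi> \<or> sat U le v \<psi>"
| "sat U le v (Imp \<phi> \<psi>) \<longleftrightarrow> (sat U le v \<phi> \<longrightarrow> sat U le v \<psi>)"
| "sat U le v (All i \<phi>) \<longleftrightarrow> (\<forall>a\<in>U. sat U le (v(i := a)) \<phi>)"
| "sat U le v (Ex i \<phi>) \<longleftrightarrow> (\<exists>a\<in>U. sat U le (v(i := a)) \<phi>)"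

text \<open>Goedel numbering: effectiveness in a formula means computability in its code.\<close>

primrec code :: "fm \<Rightarrow> nat" where
  "code (Eq i j) = prod_encode (0, prod_encode (i, j))"
| "code (Le i j) = prod_encode (1, prod_encode (i, j))"
| "code (Neg \<phi>) = prod_encode (2, code \<phi>)"
| "code (Conj \<phi> \<psi>) = prod_encode (3, prod_encode (code \<phi>, code \<psi>))"
| "code (Disj \<phi> \<psi>) = prod_encode (4, prod_encode (code \<phi>, code \<psi>))"
| "code (Imp \<phi> \<psi>) = prod_encode (5, prod_encode (code \<phi>, code \<psi>))"
| "code (All i \<phi>) = prod_encode (6, prod_encode (i, code \<phi>))"
| "code (Ex i \<phi>) = prod_encode (7, prod_encode (i, code \<phi>))"


section \<open>Definable relations over the lattice of c.e. sets\<close>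

text \<open>In \<open>\<phi>(X, Y; P\<^sub>0, \<dots>, P\<^sub>n\<^sub>-\<^sub>1)\<close> the variables \<open>X\<close>, \<open>Y\<close>, \<open>P\<^sub>i\<close> have index \<open>0\<close>, \<open>1\<close>, \<open>i + 2\<close>. The
  valuation is meaningful only if \<open>fv \<phi> \<subseteq> {..<n + 2}\<close>.\<close>

definition E_sat :: "fm \<Rightarrow> nat set \<Rightarrow> nat set \<Rightarrow> nat set list \<Rightarrow> bool" where
  "E_sat \<phi> X Y As \<longleftrightarrow> sat {W. ce W} (\<subseteq>) (\<lambda>i. (X # Y # As) ! i) \<phi>"

definition definable_rel :: "fm \<Rightarrow> nat set list \<Rightarrow> nat set set \<Rightarrow> (nat set \<times> nat set) set" where
  "definable_rel \<phi> As R = {(X, Y). X \<in> R \<and> Y \<in> R \<and> E_sat \<phi> X Y As}"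

end

theory Submission
  imports Defs
begin

text \<open>Call two members \<open>X\<close>, \<open>Y\<close> of \<open>R\<close> similar if Duplicator wins the Ehrenfeucht-Fraisse game given
  by \<open>\<phi>\<close> between the c.e. subsets of \<open>X\<close> and those of \<open>Y\<close>, both equipped with the traces of the
  parameters. As \<open>X\<close> and \<open>Y\<close> are computable, the lattice of c.e. sets is the product of its
  restrictions to \<open>X\<close>, to \<open>Y\<close> and to the complement of \<open>X \<union> Y\<close>. Playing on these factors separately,
  Duplicator can exchange two similar sets \<open>X\<close> and \<open>Y\<close>, so that \<open>\<phi>(X, Y)\<close> and \<open>\<phi>(Y, X)\<close> are
  equivalent. The number of similarity classes is bounded by an iterated exponential of the code of
  \<open>\<phi>\<close>, hence a class \<open>R\<close> exceeding this bound has two similar members.\<close>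

section \<open>Computability\<close>

lemma computes_Comp1:
  assumes "computes g xs y" "computes f [y] z"
  shows "computes (Comp f [g]) xs z"
  by (rule computes.Comp[where ys = "[y]"]) (use assms in auto)

lemma computes_Comp2:
  assumes "computes g xs y" "computes h xs y'" "computes f [y, y'] z"
  shows "computes (Comp f [g, h]) xs z"
  by (rule computes.Comp[where ys = "[y, y']"]) (use assms in auto)

lemma computes_Comp3:
  assumes "computes g xs y" "computes h xs y'" "computes i xs y''" "computes f [y, y', y''] z"
  shows "computes (Comp f [g, h, i]) xs z"
  by (rule computes.Comp[where ys = "[y, y', y'']"]) (use assms in auto)

lemma computes_Proj: "i < length xs \<Longrightarrow> y = xs ! i \<Longrightarrow> computes (Proj i) xs y"
  by (simp add: computes.Proj)

lemma ex_computes_const: "\<exists>p. \<forall>xs. computes p xs c"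
proof (induction c)
  case 0
  then show ?case by (blast intro: computes.Zero)
next
  case (Suc c)
  then obtain p where "computes p xs c" for xs by blast
  then have "computes (Comp Succ [p]) xs (Suc c)" for xs
    using computes_Comp1 computes.Succ by blast
  then show ?case by blast
qed

lemma computable_fun_const: "computable_fun (\<lambda>_. c)"
  using ex_computes_const unfolding computable_fun_def by blast

lemma computable_fun_Suc: "computable_fun Suc"
  unfolding computable_fun_def by (blast intro: computes.Succ)

lemma computable_fun_id: "computable_fun (\<lambda>x. x)"
  unfolding computable_fun_def by (rule exI[of _ "Proj 0"]) (simp add: computes_Proj)

lemma computable_fun_comp:
  assumes "computable_fun f" "computable_fun g"
  shows "computable_fun (\<lambda>x. f (g x))"
proof -
  obtain p q where "\<And>x. computes p [x] (f x)" "\<And>x. computes q [x] (g x)"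
    using assms unfolding computable_fun_def by blast
  then have "computes (Comp p [q]) [x] (f (g x))" for x
    using computes_Comp1 by blast
  then show ?thesis unfolding computable_fun_def by blast
qed

lemma computable_fun_rec:
  assumes h: "h 0 = c" "\<And>n. h (Suc n) = G n (h n)"
    and G: "\<And>n r. computes p [n, r] (G n r)"
  shows "computable_fun h"
proof -
  obtain q where q: "computes q [] c" using ex_computes_const by blast
  have "computes (PrimRec q p) [n] (h n)" for n
    by (induction n) (auto simp: h intro: computes.PrimRec_0 computes.PrimRec_Suc q G)
  then show ?thesis unfolding computable_fun_def by blast
qed

lemma computable_fun_funpow:
  assumes "computable_fun f"
  shows "computable_fun (\<lambda>n. (f ^^ n) c)"
proof -
  obtain p where "\<And>x. computes p [x] (f x)" using assms unfolding computable_fun_def by blast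
  then have "computes (Comp p [Proj 1]) [n, r] (f r)" for n r
    by (intro computes_Comp1[OF computes_Proj]) auto
  from computable_fun_rec[OF _ _ this] show ?thesis by simp
qed

text \<open>Case distinction on zero, as a primitive recursion whose step ignores the previous
  value.\<close>

definition cond_recf :: recf where
  "cond_recf = PrimRec (Proj 1) (Proj 2)"

lemma computes_cond_recf: "computes cond_recf [n, a, b] (if n = 0 then b else a)"
proof (induction n)
  case 0
  show ?case unfolding cond_recf_def by (auto intro!: computes.PrimRec_0 computes_Proj)
next
  case (Suc n)
  then show ?case unfolding cond_recf_def by (auto intro!: computes.PrimRec_Suc computes_Proj)
qed

lemma computable_fun_If:
  assumes "computable_set X" "computable_fun f" "computable_fun g"
  shows "computable_fun (\<lambda>n. if n \<in> X then f n else g n)"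
proof -
  obtain x p q where
    x: "\<And>n. computes x [n] (if n \<in> X then 1 else 0)" and
    p: "\<And>n. computes p [n] (f n)" and q: "\<And>n. computes q [n] (g n)"
    using assms unfolding computable_set_def computable_fun_def by blast
  have "computes (Comp cond_recf [x, p, q]) [n] (if n \<in> X then f n else g n)" for n
    using computes_Comp3[OF x p q computes_cond_recf, of n] by (cases "n \<in> X") auto
  then show ?thesis unfolding computable_fun_def by blast
qed

lemma computable_set_Compl:
  assumes "computable_set X"
  shows "computable_set (- X)"
proof -
  have "(\<lambda>x. if x \<in> - X then 1 else 0 :: nat) = (\<lambda>x. if x \<in> X then 0 else 1)"
    by auto
  then show ?thesis
    using computable_fun_If[OF assms computable_fun_const computable_fun_const, of 0 1]
    by (simp add: computable_set_def)
qed

lemma computable_set_even: "computable_set {n. even n}"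
proof -
  obtain z o' where z: "\<And>xs. computes z xs 0" and o': "\<And>xs. computes o' xs 1"
    using ex_computes_const by metis
  \<comment> \<open>Parity flips at each successor, so the previous value determines the next
    one.\<close>
  have G: "computes (Comp cond_recf [Proj 1, z, o']) [n, r] (if r = 0 then 1 else 0)" for n r
    by (rule computes_Comp3[OF computes_Proj z o' computes_cond_recf]) auto
  show ?thesis
    unfolding computable_set_def by (rule computable_fun_rec[OF _ _ G]) auto
qed

lemma computable_fun_half: "computable_fun (\<lambda>n. n div 2)"
proof -
  obtain e where e: "\<And>n. computes e [n] (if n \<in> {n. even n} then 1 else 0)"
    using computable_set_even unfolding computable_set_def computable_fun_def by blast
  \<comment> \<open>Passing from \<open>n\<close> to \<open>Suc n\<close> raises the half exactly
    when \<open>n\<close> is odd.\<close>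
  let ?p = "Comp cond_recf [Comp e [Proj 0], Proj 1, Comp Succ [Proj 1]]"
  have "computes ?p [n, r] (if (if n \<in> {n. even n} then 1 else 0) = (0::nat) then Suc r else r)"
    for n r
    by (rule computes_Comp3[OF computes_Comp1[OF computes_Proj e] computes_Proj
          computes_Comp1[OF computes_Proj computes.Succ] computes_cond_recf]) auto
  from computable_fun_rec[OF _ _ this] show ?thesis by auto
qed

lemma computable_fun_power2: "computable_fun (\<lambda>n. 2 ^ n)"
proof -
  let ?add = "PrimRec (Proj 0) (Comp Succ [Proj 1])"
  have add: "computes ?add [m, n] (m + n)" for m n
  proof (induction m)
    case 0
    show ?case by (auto intro!: computes.PrimRec_0 computes_Proj)
  next
    case (Suc m)
    have "computes (Comp Succ [Proj 1]) [m, m + n, n] (Suc m + n)"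
      by (rule computes_Comp1[OF computes_Proj[where y = "m + n"]])
        (simp_all add: computes.Succ)
    with Suc show ?case by (rule computes.PrimRec_Suc)
  qed
  have "computes (Comp ?add [Proj 1, Proj 1]) [n, r] (2 * r)" for n r
    unfolding mult_2 by (rule computes_Comp2[OF computes_Proj computes_Proj add]) auto
  from computable_fun_rec[OF _ _ this] show ?thesis by simp
qed

section \<open>Closure properties of c.e. sets\<close>

lemma ce_range: "computable_fun f \<Longrightarrow> ce (range f)"
  unfolding ce_def by blast

lemma ce_Int_computable:
  assumes "ce A" "computable_set X"
  shows "ce (A \<inter> X)"
proof (cases "A \<inter> X = {}")
  case True
  then show ?thesis by (simp add: ce_def)
next
  case False
  then obtain c where c: "c \<in> A" "c \<in> X" by blast
  with assms(1) obtain f where f: "computable_fun f" "A = range f"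
    unfolding ce_def by blast
  \<comment> \<open>Values outside \<open>X\<close> are redirected to the fixed element
    \<open>c\<close> of the intersection.\<close>
  have "computable_fun (\<lambda>n. if f n \<in> X then f n else c)"
    using computable_fun_comp[OF computable_fun_If[OF assms(2) computable_fun_id
          computable_fun_const[of c]] f(1)] .
  moreover have "A \<inter> X = range (\<lambda>n. if f n \<in> X then f n else c)"
    using c f(2) by (fastforce split: if_splits)
  ultimately show ?thesis by (metis ce_range)
qed

lemma ce_Un:
  assumes "ce A" "ce B"
  shows "ce (A \<union> B)"
proof (cases "A = {} \<or> B = {}")
  case True
  then show ?thesis using assms by auto
next
  case False
  with assms obtain f g where
    f: "computable_fun f" "A = range f" and g: "computable_fun g" "B = range g"
    unfolding ce_def by blast
  \<comment> \<open>The two enumerations are interleaved on even and odd arguments.\<close>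
  define h where "h n = (if n \<in> {n. even n} then f (n div 2) else g (n div 2))" for n
  have "computable_fun h"
    unfolding h_def
    by (intro computable_fun_If computable_set_even computable_fun_comp[OF f(1) computable_fun_half]
        computable_fun_comp[OF g(1) computable_fun_half])
  moreover have "A \<union> B = range h"
  proof
    have "f n = h (2 * n)" "g n = h (Suc (2 * n))" for n by (simp_all add: h_def)
    then show "A \<union> B \<subseteq> range h" unfolding f(2) g(2) by blast
    show "range h \<subseteq> A \<union> B" unfolding f(2) g(2) h_def by auto
  qed
  ultimately show ?thesis by (metis ce_range)
qed

text \<open>Both \<open>X\<close> and its complement are computable, so both pieces are c.e. This
  gluing allows the parts of a c.e. set inside and outside \<open>X\<close> to be chosen
  independently.\<close>

lemma ce_cases_computable:
  assumes "ce A" "ce B" "computable_set X"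
  shows "ce (A \<inter> X \<union> (B - X))"
  unfolding Diff_eq
  by (intro ce_Un ce_Int_computable computable_set_Compl assms)

section \<open>Types of valuations\<close>

text \<open>Equality of \<open>tp \<phi> U v\<close> and \<open>tp \<phi> U' v'\<close> amounts to a back-and-forth system between \<open>U\<close> and \<open>U'\<close>
  whose moves follow the quantifiers of \<open>\<phi>\<close>. Negations are ignored and both quantifiers are treated
  alike, since the type only serves as an upper bound for what \<open>\<phi>\<close> can express.\<close>

primrec tp :: "fm \<Rightarrow> 'a set set \<Rightarrow> (nat \<Rightarrow> 'a set) \<Rightarrow> nat" where
  "tp (Eq i j) U v = of_bool (v i = v j)"
| "tp (Le i j) U v = of_bool (v i \<subseteq> v j)"
| "tp (Neg \<phi>) U v = tp \<phi> U v"
| "tp (Conj \<phi> \<psi>) U v = prod_encode (tp \<phi> U v, tp \<psi> U v)"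
| "tp (Disj \<phi> \<psi>) U v = prod_encode (tp \<phi> U v, tp \<psi> U v)"
| "tp (Imp \<phi> \<psi>) U v = prod_encode (tp \<phi> U v, tp \<psi> U v)"
| "tp (All i \<phi>) U v = set_encode ((\<lambda>a. tp \<phi> U (v(i := a))) ` U)"
| "tp (Ex i \<phi>) U v = set_encode ((\<lambda>a. tp \<phi> U (v(i := a))) ` U)"

text \<open>The tower starts at \<open>7\<close> because \<open>2 * n\<^sup>2 \<le> 2 ^ n\<close> fails for \<open>n = 6\<close>.\<close>

definition tower :: "nat \<Rightarrow> nat" where
  "tower n = ((^) 2 ^^ n) 7"

lemma tower_Suc: "tower (Suc n) = 2 ^ tower n"
  by (simp add: tower_def)

lemma strict_mono_tower: "strict_mono tower"
  by (simp add: strict_mono_Suc_iff tower_Suc)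

lemma tower_mono: "m \<le> n \<Longrightarrow> tower m \<le> tower n"
  using strict_mono_tower by (simp add: strict_mono_less_eq)

lemma tower_ge_7: "7 \<le> tower n"
  using tower_mono[of 0 n] by (simp add: tower_def)

lemma computable_fun_tower: "computable_fun tower"
  unfolding tower_def by (rule computable_fun_funpow[OF computable_fun_power2])

section \<open>Numerical bounds for codes of pairs and finite sets\<close>

lemma double_square_le_power2: "7 \<le> n \<Longrightarrow> 2 * n * n \<le> (2::nat) ^ n"
proof (induction n rule: nat_induct_at_least)
  case (Suc n)
  \<comment> \<open>This absorbs the lower-order terms: 2(n+1)^2 = 2n^2 + 4n + 2 is at most
    4n^2.\<close>
  have "7 * n \<le> n * n" using Suc.hyps by simp
  then have "2 * Suc n * Suc n \<le> 2 * (2 * n * n)" using Suc.hyps by (simp; linarith)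
  also have "\<dots> \<le> 2 ^ Suc n" using Suc.IH by simp
  finally show ?case .
qed simp

lemma prod_encode_less_power2:
  assumes "a < n" "b < n" "7 \<le> n"
  shows "prod_encode (a, b) < 2 ^ n"
proof -
  have "2 * triangle (a + b) = (a + b) * Suc (a + b)"
    by (simp add: triangle_def)
  also have "\<dots> \<le> (2 * (n - 1)) * (2 * n - 1)"
    using assms by (intro mult_le_mono) auto
  also have "\<dots> = 2 * ((n - 1) * (2 * n - 1))" by simp
  finally have "prod_encode (a, b) \<le> (n - 1) * (2 * n - 1) + (n - 1)"
    using assms by (simp add: prod_encode_def)
  also have "\<dots> = (n - 1) * (2 * n)"
    by (cases n) simp_all
  also have "\<dots> < n * (2 * n)"
    using assms by simp
  also have "\<dots> \<le> 2 ^ n"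
    using double_square_le_power2[OF assms(3)] by (simp add: mult.commute mult.left_commute)
  finally show ?thesis .
qed

lemma set_encode_less_power2:
  assumes "A \<subseteq> {..<n}"
  shows "set_encode A < 2 ^ n"
proof -
  have "set_encode A \<le> (\<Sum>i<n. 2 ^ i)"
    unfolding set_encode_def using assms by (intro sum_mono2) auto
  also have "\<dots> < 2 ^ n" by (simp add: lessThan_atLeast0 sum_power2)
  finally show ?thesis .
qed

text \<open>Compound formulas carry tags of at least 2, so their codes exceed those of their parts
  and leave room for one more tower level.\<close>

lemma less_prod_encode:
  assumes "2 \<le> m"
  shows "n < prod_encode (m, n)"
proof -
  have "k \<le> triangle k" for k by (induction k) auto
  from this[of "m + n"] assms show ?thesis by (simp add: prod_encode_def)
qed

lemma less_prod_encode_nested: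
  assumes "2 \<le> m"
  shows "a < prod_encode (m, prod_encode (a, b))" "b < prod_encode (m, prod_encode (a, b))"
  using less_prod_encode[OF assms] le_prod_encode_1 le_prod_encode_2 le_less_trans by blast+

lemma prod_encode_less_tower:
  assumes "a < tower m" "b < tower n" "m < k" "n < k"
  shows "prod_encode (a, b) < tower k"
proof -
  have "prod_encode (a, b) < tower (Suc (max m n))"
    unfolding tower_Suc
    by (intro prod_encode_less_power2 tower_ge_7 less_le_trans[OF assms(1)]
        less_le_trans[OF assms(2)] tower_mono) auto
  also have "\<dots> \<le> tower k" using assms by (intro tower_mono) auto
  finally show ?thesis .
qed

lemma set_encode_less_tower:
  assumes "A \<subseteq> {..<tower n}" "n < k"
  shows "set_encode A < tower k"
  using set_encode_less_power2[OF assms(1)] tower_mono[of "Suc n" k] assms(2)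
  by (simp add: tower_Suc)

text \<open>Each pairing or set coding costs one exponential, paid for by the larger code of the
  compound formula. The bound is uniform in \<open>U\<close> and \<open>v\<close>.\<close>

lemma tp_less_tower: "tp \<phi> U v < tower (code \<phi>)"
proof (induction \<phi> arbitrary: v)
  case (Eq i j)
  show ?case using tower_ge_7[of "code (Eq i j)"] by (simp add: of_bool_def)
next
  case (Le i j)
  show ?case using tower_ge_7[of "code (Le i j)"] by (simp add: of_bool_def)
next
  case (Neg \<phi>)
  have "tower (code \<phi>) \<le> tower (code (Neg \<phi>))"
    by (intro tower_mono) (simp add: less_imp_le less_prod_encode)
  from less_le_trans[OF Neg this] show ?case by simp
next
  case (Conj \<phi> \<psi>)
  show ?case unfolding tp.simps code.simps
    by (rule prod_encode_less_tower[OF Conj.IH]) (simp_all add: less_prod_encode_nested)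
next
  case (Disj \<phi> \<psi>)
  show ?case unfolding tp.simps code.simps
    by (rule prod_encode_less_tower[OF Disj.IH]) (simp_all add: less_prod_encode_nested)
next
  case (Imp \<phi> \<psi>)
  show ?case unfolding tp.simps code.simps
    by (rule prod_encode_less_tower[OF Imp.IH]) (simp_all add: less_prod_encode_nested)
next
  case (All i \<phi>)
  show ?case unfolding tp.simps code.simps
    by (rule set_encode_less_tower[of _ "code \<phi>"]) (use All.IH in \<open>auto simp: less_prod_encode_nested\<close>)
next
  case (Ex i \<phi>)
  show ?case unfolding tp.simps code.simps
    by (rule set_encode_less_tower[of _ "code \<phi>"]) (use Ex.IH in \<open>auto simp: less_prod_encode_nested\<close>)
qed

text \<open>The coding \<open>set_encode\<close> is faithful only on finite sets, whereas the
  universe may be infinite.\<close>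

lemma finite_tp_image: "finite ((\<lambda>a. tp \<phi> U (v a)) ` S)"
  by (rule finite_subset[of _ "{..<tower (code \<phi>)}"]) (auto simp: tp_less_tower)

text \<open>Injectivity of the set coding turns equal types into Duplicator's reply to the move
  \<open>a\<close>.\<close>

lemma tp_quantifier_eqD:
  assumes "set_encode ((\<lambda>a. tp \<phi> U (v(i := a))) ` U) = set_encode ((\<lambda>a. tp \<phi> U' (v'(i := a))) ` U')"
    and "a \<in> U"
  obtains a' where "a' \<in> U'" "tp \<phi> U (v(i := a)) = tp \<phi> U' (v'(i := a'))"
proof -
  have "(\<lambda>a. tp \<phi> U (v(i := a))) ` U = (\<lambda>a. tp \<phi> U' (v'(i := a))) ` U'"
    using inj_onD[OF inj_on_set_encode assms(1)] by (simp add: finite_tp_image)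
  with assms(2) that show thesis by blast
qed

section \<open>Exchanging two sets of the same type\<close>

text \<open>If \<open>C\<close> consists of the c.e. sets and \<open>Z\<close> is computable, these
  are exactly the c.e. subsets of \<open>Z\<close>.\<close>

definition traces :: "'a set set \<Rightarrow> 'a set \<Rightarrow> 'a set set" where
  "traces C Z = (\<lambda>W. W \<inter> Z) ` C"

text \<open>Duplicator's invariant in the game of \<open>C\<close> against itself: moves are
  answered crosswise on \<open>X\<close> and \<open>Y\<close> and copied elsewhere.\<close>

definition swapped :: "'a set set \<Rightarrow> 'a set \<Rightarrow> 'a set \<Rightarrow> fm \<Rightarrow> (nat \<Rightarrow> 'a set) \<Rightarrow> (nat \<Rightarrow> 'a set) \<Rightarrow> bool" where
  "swapped C X Y \<phi> v w \<longleftrightarrow>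
     (\<forall>i. v i - (X \<union> Y) = w i - (X \<union> Y)) \<and>
     tp \<phi> (traces C X) (\<lambda>i. v i \<inter> X) = tp \<phi> (traces C Y) (\<lambda>i. w i \<inter> Y) \<and>
     tp \<phi> (traces C Y) (\<lambda>i. v i \<inter> Y) = tp \<phi> (traces C X) (\<lambda>i. w i \<inter> X)"

lemma swapped_sym: "swapped C X Y \<phi> v w \<Longrightarrow> swapped C X Y \<phi> w v"
  unfolding swapped_def by metis

lemma fun_upd_Int: "(\<lambda>j. (v(i := a)) j \<inter> Z) = (\<lambda>j. v j \<inter> Z)(i := a \<inter> Z)"
  by (simp add: fun_eq_iff)

lemma swapped_quantifier:
  assumes C: "\<And>A B Z. A \<in> C \<Longrightarrow> B \<in> C \<Longrightarrow> Z \<in> {X, Y} \<Longrightarrow> A \<inter> Z \<union> (B - Z) \<in> C"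
    and disj: "X \<inter> Y = {}"
    and sw: "swapped C X Y \<psi> v w"
    and \<psi>: "\<psi> = All i \<phi> \<or> \<psi> = Ex i \<phi>"
    and a: "a \<in> C"
  shows "\<exists>b\<in>C. swapped C X Y \<phi> (v(i := a)) (w(i := b))"
proof -
  have tr: "a \<inter> X \<in> traces C X" "a \<inter> Y \<in> traces C Y"
    using a by (auto simp: traces_def)
  obtain b1 where b1: "b1 \<in> traces C Y" "tp \<phi> (traces C X) ((\<lambda>i. v i \<inter> X)(i := a \<inter> X)) =
      tp \<phi> (traces C Y) ((\<lambda>i. w i \<inter> Y)(i := b1))"
    using sw \<psi> unfolding swapped_def by (auto elim!: tp_quantifier_eqD[OF _ tr(1)])
  obtain b2 where b2: "b2 \<in> traces C X" "tp \<phi> (traces C Y) ((\<lambda>i. v i \<inter> Y)(i := a \<inter> Y)) =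
      tp \<phi> (traces C X) ((\<lambda>i. w i \<inter> X)(i := b2))"
    using sw \<psi> unfolding swapped_def by (auto elim!: tp_quantifier_eqD[OF _ tr(2)])
  obtain B1 B2 where B: "B1 \<in> C" "b1 = B1 \<inter> Y" "B2 \<in> C" "b2 = B2 \<inter> X"
    using b1(1) b2(1) unfolding traces_def by blast
  \<comment> \<open>The reply is glued first along \<open>X\<close>, then along \<open>Y\<close>;
    disjointness keeps the part chosen on \<open>X\<close> intact.\<close>
  define b where "b = B1 \<inter> Y \<union> ((B2 \<inter> X \<union> (a - X)) - Y)"
  have "b \<in> C" unfolding b_def using C a B by simp
  moreover have "b \<inter> Y = b1" "b \<inter> X = b2" "b - (X \<union> Y) = a - (X \<union> Y)"
    using B disj unfolding b_def by auto
  then have "swapped C X Y \<phi> (v(i := a)) (w(i := b))"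
    using sw b1(2) b2(2) unfolding swapped_def fun_upd_Int by simp
  ultimately show ?thesis by blast
qed

text \<open>Inclusion is decided factor by factor, which settles the atomic case of the
  game.\<close>

lemma subset_iff_parts:
  "A \<subseteq> B \<longleftrightarrow> A \<inter> X \<subseteq> B \<inter> X \<and> A \<inter> Y \<subseteq> B \<inter> Y \<and> A - (X \<union> Y) \<subseteq> B - (X \<union> Y)"
  by blast

lemma eq_iff_parts:
  "A = B \<longleftrightarrow> A \<inter> X = B \<inter> X \<and> A \<inter> Y = B \<inter> Y \<and> A - (X \<union> Y) = B - (X \<union> Y)"
  unfolding set_eq_subset subset_iff_parts[of A B X Y] subset_iff_parts[of B A X Y] by argo

lemma sat_swapped:
  assumes C: "\<And>A B Z. A \<in> C \<Longrightarrow> B \<in> C \<Longrightarrow> Z \<in> {X, Y} \<Longrightarrow> A \<inter> Z \<union> (B - Z) \<in> C"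
    and disj: "X \<inter> Y = {}"
    and "swapped C X Y \<phi> v w"
  shows "sat C (\<subseteq>) v \<phi> \<longleftrightarrow> sat C (\<subseteq>) w \<phi>"
  using assms(3)
proof (induction \<phi> arbitrary: v w)
  case (Eq i j)
  then show ?case
    using eq_iff_parts[of "v i" "v j" X Y] eq_iff_parts[of "w i" "w j" X Y]
    by (simp add: swapped_def of_bool_eq_iff conj_ac)
next
  case (Le i j)
  then show ?case
    using subset_iff_parts[of "v i" "v j" X Y] subset_iff_parts[of "w i" "w j" X Y]
    by (simp add: swapped_def of_bool_eq_iff conj_ac)
next
  case (Neg \<phi>)
  then show ?case by (simp add: swapped_def)
next
  case (Conj \<phi> \<psi>)
  then have "swapped C X Y \<phi> v w" "swapped C X Y \<psi> v w" by (simp_all add: swapped_def)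
  with Conj.IH show ?case by simp
next
  case (Disj \<phi> \<psi>)
  then have "swapped C X Y \<phi> v w" "swapped C X Y \<psi> v w" by (simp_all add: swapped_def)
  with Disj.IH show ?case by simp
next
  case (Imp \<phi> \<psi>)
  then have "swapped C X Y \<phi> v w" "swapped C X Y \<psi> v w" by (simp_all add: swapped_def)
  with Imp.IH show ?case by simp
next
  case (All i \<phi>)
  have "\<exists>b\<in>C. swapped C X Y \<phi> (v(i := a)) (w(i := b))" if "a \<in> C" for a
    by (rule swapped_quantifier[OF C disj All.prems _ that]) simp_all
  \<comment> \<open>The equivalence also needs replies to moves on the \<open>w\<close> side; the
    invariant is symmetric.\<close>
  moreover have "\<exists>b\<in>C. swapped C X Y \<phi> (w(i := a)) (v(i := b))" if "a \<in> C" for a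
    by (rule swapped_quantifier[OF C disj swapped_sym[OF All.prems] _ that]) simp_all
  ultimately show ?case using All.IH unfolding sat.simps by meson
next
  case (Ex i \<phi>)
  have "\<exists>b\<in>C. swapped C X Y \<phi> (v(i := a)) (w(i := b))" if "a \<in> C" for a
    by (rule swapped_quantifier[OF C disj Ex.prems _ that]) simp_all
  moreover have "\<exists>b\<in>C. swapped C X Y \<phi> (w(i := a)) (v(i := b))" if "a \<in> C" for a
    by (rule swapped_quantifier[OF C disj swapped_sym[OF Ex.prems] _ that]) simp_all
  ultimately show ?case using Ex.IH unfolding sat.simps by meson
qed

text \<open>The set \<open>Z\<close> plays the role of \<open>X\<close> in the first component and that of \<open>Y\<close> in the second.\<close>

definition set_tp :: "fm \<Rightarrow> nat set list \<Rightarrow> nat set \<Rightarrow> nat" where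
  "set_tp \<phi> As Z = prod_encode
     (tp \<phi> (traces {W. ce W} Z) (\<lambda>i. (Z # {} # As) ! i \<inter> Z),
      tp \<phi> (traces {W. ce W} Z) (\<lambda>i. ({} # Z # As) ! i \<inter> Z))"

lemma set_tp_less_tower: "set_tp \<phi> As Z < tower (Suc (code \<phi>))"
  unfolding set_tp_def by (rule prod_encode_less_tower[OF tp_less_tower tp_less_tower]) auto

lemma E_sat_swap:
  assumes "computable_set X" "computable_set Y" "X \<inter> Y = {}" "set_tp \<phi> As X = set_tp \<phi> As Y"
  shows "E_sat \<phi> X Y As \<longleftrightarrow> E_sat \<phi> Y X As"
  unfolding E_sat_def
proof (rule sat_swapped)
  \<comment> \<open>By disjointness the other set has empty trace, so each type involves only one of
    \<open>X\<close>, \<open>Y\<close> and the parameters.\<close>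
  have trace:
    "(\<lambda>i. (X # Y # As) ! i \<inter> X) = (\<lambda>i. (X # {} # As) ! i \<inter> X)"
    "(\<lambda>i. (Y # X # As) ! i \<inter> Y) = (\<lambda>i. (Y # {} # As) ! i \<inter> Y)"
    "(\<lambda>i. (X # Y # As) ! i \<inter> Y) = (\<lambda>i. ({} # Y # As) ! i \<inter> Y)"
    "(\<lambda>i. (Y # X # As) ! i \<inter> X) = (\<lambda>i. ({} # X # As) ! i \<inter> X)"
    using assms(3) by (auto simp: fun_eq_iff nth_Cons split: nat.splits)
  \<comment> \<open>At indices 0 and 1 both sides are empty; from index 2 on the valuations
    agree.\<close>
  have "(X # Y # As) ! i - (X \<union> Y) = (Y # X # As) ! i - (X \<union> Y)" for i
    by (auto simp: nth_Cons split: nat.splits)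
  then show "swapped {W. ce W} X Y \<phi> (\<lambda>i. (X # Y # As) ! i) (\<lambda>i. (Y # X # As) ! i)"
    using assms(4) unfolding swapped_def trace by (simp add: set_tp_def)
qed (use assms in \<open>auto intro: ce_cases_computable\<close>)

theorem theorem4p22:
  "\<exists>k :: nat \<Rightarrow> nat. computable_fun k \<and>
     (\<forall>(\<phi> :: fm) (As :: nat set list) (R :: nat set set).
        fv \<phi> \<subseteq> {..<length As + 2} \<longrightarrow>
        (\<forall>A\<in>set As. ce A) \<longrightarrow>
        finite R \<longrightarrow>
        (\<forall>X\<in>R. infinite X \<and> computable_set X) \<longrightarrow>
        pairwise disjnt R \<longrightarrow>
        k (code \<phi>) \<le> card R \<longrightarrow>
        \<not> linear_order_on R (definable_rel \<phi> As R) \<and>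
        \<not> strict_linear_order_on R (definable_rel \<phi> As R))"
proof (intro exI[of _ "\<lambda>c. Suc (tower (Suc c))"] conjI allI impI)
  show "computable_fun (\<lambda>c. Suc (tower (Suc c)))"
    by (rule computable_fun_comp[OF computable_fun_Suc
          computable_fun_comp[OF computable_fun_tower computable_fun_Suc]])
next
  fix \<phi> :: fm and As :: "nat set list" and R :: "nat set set"
  assume R: "\<forall>X\<in>R. infinite X \<and> computable_set X" "pairwise disjnt R"
    and card: "Suc (tower (Suc (code \<phi>))) \<le> card R"
  \<comment> \<open>There are fewer possible types than members of \<open>R\<close>, so two members
    share a type.\<close>
  have "card (set_tp \<phi> As ` R) \<le> card {..<tower (Suc (code \<phi>))}"
    by (intro card_mono) (auto simp: set_tp_less_tower)
  with card have "\<not> inj_on (set_tp \<phi> As) R" by (intro pigeonhole) simp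
  then obtain X Y where XY: "X \<in> R" "Y \<in> R" "X \<noteq> Y" "set_tp \<phi> As X = set_tp \<phi> As Y"
    unfolding inj_on_def by blast
  then have "E_sat \<phi> X Y As \<longleftrightarrow> E_sat \<phi> Y X As"
    using R by (intro E_sat_swap) (auto simp: pairwise_def disjnt_def)
  then have swap: "(X, Y) \<in> definable_rel \<phi> As R \<longleftrightarrow> (Y, X) \<in> definable_rel \<phi> As R"
    using XY by (simp add: definable_rel_def)
  \<comment> \<open>Totality relates \<open>X\<close> and \<open>Y\<close> one way,
    \<open>swap\<close> gives the other way, and antisymmetry fails.\<close>
  show "\<not> linear_order_on R (definable_rel \<phi> As R)"
    using swap XY unfolding linear_order_on_def partial_order_on_def total_on_def
    by (metis antisymD)
  \<comment> \<open>Here the two directions compose by transitivity to a loop, against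
    irreflexivity.\<close>
  show "\<not> strict_linear_order_on R (definable_rel \<phi> As R)"
    using swap XY unfolding strict_linear_order_on_def total_on_def
    by (metis irreflD transD)
qed

end
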